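(* Let $0<|q|<1$ and $z\in\mathbb{C}^*$ with $z\neq1$. Then $$(zq,q/z,q^2;q^2)_\infty F_8(z,q)=\sum_{\substack{n,j\in\mathbb{Z}\\1\le j\le |n|}}\operatorname{sg}(n)(-1)^{j-1}q^{2n^2-n-j^2+j}\cdot\frac{z^{1-j}-z^{j}}{1-z}.$$
   Context: Standard $q$-Pochhammer notation: $(a;q)_0=1$, $(a;q)_n=\prod_{k=0}^{n-1}(1-aq^k)$, $(a;q)_\infty=\prod_{k\ge0}(1-aq^k)$, $(a_1,\dots,a_m;q)_n=\prod_i(a_i;q)_n$. $\operatorname{sg}(n)=1$ if $n\ge0$ and $\operatorname{sg}(n)=-1$ if $n<0$. Define $$F_8(z,q)=\sum_{n=0}^{\infty}\frac{(-1)^n(q;q^2)_n\,q^{(n+1)^2}}{(zq,q/z;q^2)_{n+1}}.$$ *)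

theory Defs
  imports "HOL-Analysis.Analysis"
begin

definition qpoch :: "complex \<Rightarrow> complex \<Rightarrow> nat \<Rightarrow> complex" where
  "qpoch a q n = (\<Prod>k<n. 1 - a * q ^ k)"

text \<open>The library's \<^const>\<open>prodinf\<close> allows finitely many vanishing factors, so for
  \<open>norm q < 1\<close> this is the usual infinite product for every \<open>a\<close>.\<close>

definition qpoch_inf :: "complex \<Rightarrow> complex \<Rightarrow> complex" where
  "qpoch_inf a q = (\<Prod>k. 1 - a * q ^ k)"

definition qpochs :: "complex list \<Rightarrow> complex \<Rightarrow> nat \<Rightarrow> complex" where
  "qpochs as q n = (\<Prod>a\<leftarrow>as. qpoch a q n)"

definition qpochs_inf :: "complex list \<Rightarrow> complex \<Rightarrow> complex" where
  "qpochs_inf as q = (\<Prod>a\<leftarrow>as. qpoch_inf a q)"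

text \<open>Unlike the library's \<^const>\<open>sgn\<close>, this takes the value 1 at 0.\<close>

definition sg :: "int \<Rightarrow> complex" where
  "sg n = (if n \<ge> 0 then 1 else -1)"

text \<open>The series has a vanishing denominator exactly when \<open>z\<close> is an odd power (of positive or
  negative exponent) of \<open>q\<close>; at those points the value below is meaningless.\<close>

definition F8 :: "complex \<Rightarrow> complex \<Rightarrow> complex" where
  "F8 z q = (\<Sum>n. (-1) ^ n * qpoch q (q\<^sup>2) n * q ^ ((n + 1)\<^sup>2) /
                   qpochs [z * q, q / z] (q\<^sup>2) (n + 1))"

end

theory Submission
  imports Defs "HOL-Complex_Analysis.Complex_Analysis"
begin

text \<open>
  Write \<open>p = q\<^sup>2\<close> and \<open>T n z = (z q\<^bsup>2n+1\<^esup>, q\<^bsup>2n+1\<^esup>/z; p)\<^sub>\<infinity>\<close>. Multiplying through by the infinite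
  product turns the left-hand side into \<open>(p; p)\<^sub>\<infinity> S(z)\<close>, where \<open>S\<close> is a series in the \<open>T n\<close> without
  denominators and hence holomorphic on the punctured plane. For \<open>H(z) = (1 - z) (p; p)\<^sub>\<infinity> S(z)\<close> the
  expression \<open>H(z) + H(p z) / (p z)\<close> telescopes termwise to \<open>\<theta>(z) - \<theta>(p z)\<close> with
  \<open>\<theta>(z) = (z q, q/z, p; p)\<^sub>\<infinity>\<close>. By the Jacobi triple product, \<open>1 - z\<close> times the double sum satisfies
  the same functional equation. The difference \<open>E\<close> of the two sides is therefore holomorphic on the
  punctured plane with \<open>E(p z) = - p z E(z)\<close>. This makes \<open>E\<close> bounded, and Liouville's theorem
  applied to \<open>E \<circ> exp\<close> gives \<open>E = 0\<close>.
\<close>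

subsection \<open>Infinite products and Euler's expansion\<close>

lemma qpoch_0 [simp]: "qpoch x p 0 = 1"
  by (simp add: qpoch_def)

lemma qpoch_Suc: "qpoch x p (Suc n) = qpoch x p n * (1 - x * p ^ n)"
  by (simp add: qpoch_def)

lemma qpoch_Suc_shift: "qpoch x p (Suc n) = (1 - x) * qpoch (x * p) p n"
  unfolding qpoch_def prod.lessThan_Suc_shift by (simp add: mult_ac)

lemma qpoch_LIMSEQ:
  assumes "norm p < 1"
  shows "qpoch x p \<longlonglongrightarrow> qpoch_inf x p"
proof -
  have "summable (\<lambda>k. norm (x * p ^ k))"
    using assms by (simp add: norm_mult norm_power summable_mult summable_geometric)
  hence "summable (\<lambda>k. norm ((1 - x * p ^ k) - 1))" by (simp add: norm_minus_commute)
  hence "convergent_prod (\<lambda>k. 1 - x * p ^ k)"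
    by (intro abs_convergent_prod_imp_convergent_prod summable_imp_abs_convergent_prod)
  hence "(\<lambda>n. \<Prod>k\<le>n. 1 - x * p ^ k) \<longlonglongrightarrow> qpoch_inf x p"
    unfolding qpoch_inf_def by (rule convergent_prod_LIMSEQ)
  hence "(\<lambda>n. qpoch x p (Suc n)) \<longlonglongrightarrow> qpoch_inf x p"
    by (simp add: qpoch_def lessThan_Suc_atMost)
  thus ?thesis by (simp only: filterlim_sequentially_Suc)
qed

lemma qpoch_bounded:
  assumes "norm p < 1"
  obtains C where "C > 0" "\<And>n. norm (qpoch x p n) \<le> C"
proof -
  have "Bseq (qpoch x p)"
    by (rule convergent_imp_Bseq[OF convergentI[OF qpoch_LIMSEQ[OF assms]]])
  then obtain K where "K > 0" "\<forall>n. norm (qpoch x p n) \<le> K" by (rule BseqE)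
  thus ?thesis using that by blast
qed

lemma qpoch_inf_shift:
  assumes "norm p < 1"
  shows "qpoch_inf x p = (1 - x) * qpoch_inf (x * p) p"
proof (rule LIMSEQ_unique)
  show "(\<lambda>n. qpoch x p (Suc n)) \<longlonglongrightarrow> qpoch_inf x p"
    using qpoch_LIMSEQ[OF assms] by (simp only: filterlim_sequentially_Suc)
  show "(\<lambda>n. qpoch x p (Suc n)) \<longlonglongrightarrow> (1 - x) * qpoch_inf (x * p) p"
    unfolding qpoch_Suc_shift by (intro tendsto_intros qpoch_LIMSEQ assms)
qed

lemma qpoch_inf_split:
  assumes "norm p < 1"
  shows "qpoch_inf x p = qpoch x p n * qpoch_inf (x * p ^ n) p"
proof (induction n)
  case (Suc n)
  show ?case
    using Suc qpoch_inf_shift[OF assms, of "x * p ^ n"] by (simp add: qpoch_Suc mult_ac)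
qed simp

lemma one_minus_power_nonzero:
  fixes p :: complex
  assumes "norm p < 1"
  shows "1 - p ^ Suc n \<noteq> 0"
proof
  assume "1 - p ^ Suc n = 0"
  hence "norm (p ^ Suc n) = 1" by (metis eq_iff_diff_eq_0 norm_one)
  moreover have "norm (p ^ Suc n) < 1"
    using assms by (metis norm_ge_zero norm_power power_less_one_iff zero_less_Suc)
  ultimately show False by simp
qed

text \<open>Euler's coefficient \<open>(-1)^a p^(a(a-1)/2) / (p; p)_a\<close> of \<open>x^a\<close>
  in \<open>(x; p)_inf\<close>. The product form exposes the ratio of consecutive
  coefficients.\<close>

definition euler_coeff :: "complex \<Rightarrow> nat \<Rightarrow> complex" where
  "euler_coeff p a = (\<Prod>k<a. - (p ^ k) / (1 - p ^ Suc k))"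

lemma euler_coeff_Suc:
  assumes "norm p < 1"
  shows "euler_coeff p (Suc a) * (1 - p ^ Suc a) = - (p ^ a) * euler_coeff p a"
  using one_minus_power_nonzero[OF assms, of a] by (simp add: euler_coeff_def)

text \<open>The ratio of consecutive terms has the factor \<open>p ^ a\<close> and tends to 0 for
  every \<open>x\<close>, so the series defines an entire function.\<close>

lemma summable_euler:
  assumes "norm p < 1"
  shows "summable (\<lambda>a. norm (euler_coeff p a * x ^ a))"
proof -
  have "(\<lambda>a. norm (p ^ a * x / (1 - p ^ Suc a))) \<longlonglongrightarrow> norm (0 * x / (1 - 0))"
    by (intro tendsto_intros LIMSEQ_Suc LIMSEQ_power_zero assms) simp_all
  hence "eventually (\<lambda>a. norm (p ^ a * x / (1 - p ^ Suc a)) < 1/2) sequentially"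
    by (rule order_tendstoD) simp
  then obtain N where N: "\<And>a. a \<ge> N \<Longrightarrow> norm (p ^ a * x / (1 - p ^ Suc a)) < 1/2"
    by (auto simp: eventually_sequentially)
  show ?thesis
  proof (rule summable_ratio_test[of "1/2" N])
    fix a assume "a \<ge> N"
    have "euler_coeff p (Suc a) * x ^ Suc a = - (p ^ a * x / (1 - p ^ Suc a)) * (euler_coeff p a * x ^ a)"
      by (simp add: euler_coeff_def)
    hence "norm (euler_coeff p (Suc a) * x ^ Suc a)
        = norm (p ^ a * x / (1 - p ^ Suc a)) * norm (euler_coeff p a * x ^ a)"
      by (simp only: norm_mult norm_minus_cancel)
    also have "\<dots> \<le> 1/2 * norm (euler_coeff p a * x ^ a)"
      using N[OF \<open>a \<ge> N\<close>] by (intro mult_right_mono) auto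
    finally show "norm (norm (euler_coeff p (Suc a) * x ^ Suc a)) \<le> 1/2 * norm (norm (euler_coeff p a * x ^ a))"
      by simp
  qed simp
qed

lemma entire_power_series:
  fixes c :: "nat \<Rightarrow> complex"
  assumes "\<And>x. (\<lambda>n. c n * x ^ n) sums f x"
  shows "f holomorphic_on UNIV"
proof -
  have "f holomorphic_on ball 0 r" for r
    by (rule power_series_holomorphic) (use assms in simp)
  hence "f field_differentiable at x" for x
    by (rule holomorphic_on_imp_differentiable_at[of _ "ball 0 (norm x + 1)"]) auto
  thus ?thesis
    by (simp add: holomorphic_on_def)
qed

text \<open>The coefficient recurrence gives \<open>f x = (1 - x) * f (x * p)\<close>. Iteration
  yields \<open>f x = qpoch x p n * f (x * p ^ n)\<close>, and continuity at 0 with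
  \<open>f 0 = 1\<close> identifies the limit.\<close>

lemma qpoch_inf_sums:
  assumes "norm p < 1"
  shows "(\<lambda>a. euler_coeff p a * x ^ a) sums qpoch_inf x p"
proof -
  define f where "f = (\<lambda>x. \<Sum>a. euler_coeff p a * x ^ a)"
  have sums: "(\<lambda>a. euler_coeff p a * x ^ a) sums f x" for x
    unfolding f_def using summable_norm_cancel[OF summable_euler[OF assms]] by (rule summable_sums)
  have shift: "f x = (1 - x) * f (x * p)" for x
  proof -
    have "(\<lambda>a. euler_coeff p a * x ^ a - euler_coeff p a * (x * p) ^ a) sums (f x - f (x * p))"
      by (intro sums_diff sums)
    hence "(\<lambda>a. euler_coeff p (Suc a) * x ^ Suc a - euler_coeff p (Suc a) * (x * p) ^ Suc a)
        sums (f x - f (x * p))"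
      by (subst sums_Suc_iff) simp
    moreover have "euler_coeff p (Suc a) * x ^ Suc a - euler_coeff p (Suc a) * (x * p) ^ Suc a
        = - x * (euler_coeff p a * (x * p) ^ a)" for a
    proof -
      have "euler_coeff p (Suc a) * x ^ Suc a - euler_coeff p (Suc a) * (x * p) ^ Suc a
          = (euler_coeff p (Suc a) * (1 - p ^ Suc a)) * x ^ Suc a"
        by (simp add: algebra_simps power_mult_distrib)
      thus ?thesis
        unfolding euler_coeff_Suc[OF assms] by (simp add: algebra_simps power_mult_distrib)
    qed
    ultimately have "(\<lambda>a. - x * (euler_coeff p a * (x * p) ^ a)) sums (f x - f (x * p))"
      by simp
    moreover have "(\<lambda>a. - x * (euler_coeff p a * (x * p) ^ a)) sums (- x * f (x * p))"
      by (intro sums_mult sums)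
    ultimately have "f x - f (x * p) = - x * f (x * p)"
      using sums_unique2 by blast
    thus ?thesis by (simp add: algebra_simps)
  qed
  have f_eq: "f x = qpoch x p n * f (x * p ^ n)" for n
  proof (induction n)
    case (Suc n)
    show ?case
      using Suc shift[of "x * p ^ n"] by (simp add: qpoch_Suc mult_ac)
  qed simp
  have "f holomorphic_on UNIV"
    using sums by (rule entire_power_series)
  hence "isCont f 0"
    using continuous_on_eq_continuous_at holomorphic_on_imp_continuous_on open_UNIV by blast
  moreover have "(\<lambda>n. x * p ^ n) \<longlonglongrightarrow> x * 0"
    by (intro tendsto_intros LIMSEQ_power_zero assms)
  ultimately have "(\<lambda>n. f (x * p ^ n)) \<longlonglongrightarrow> f 0"
    using isCont_tendsto_compose[of 0 f "\<lambda>n. x * p ^ n" sequentially] by simp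
  hence "(\<lambda>n. qpoch x p n * f (x * p ^ n)) \<longlonglongrightarrow> qpoch_inf x p * f 0"
    by (intro tendsto_intros qpoch_LIMSEQ assms)
  moreover have "f 0 = 1"
    unfolding f_def by (simp add: euler_coeff_def powser_zero)
  ultimately have "(\<lambda>n. f x) \<longlonglongrightarrow> qpoch_inf x p"
    by (simp add: f_eq[symmetric])
  hence "f x = qpoch_inf x p"
    by (rule LIMSEQ_unique[OF tendsto_const])
  thus ?thesis using sums by metis
qed

lemma qpoch_inf_holomorphic:
  assumes "norm p < 1"
  shows "(\<lambda>x. qpoch_inf x p) holomorphic_on UNIV"
  using qpoch_inf_sums[OF assms] by (rule entire_power_series)

lemma qpoch_inf_0 [simp]: "qpoch_inf 0 p = 1"
  by (simp add: qpoch_inf_def)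

lemma isCont_qpoch_inf:
  assumes "norm p < 1"
  shows "isCont (\<lambda>x. qpoch_inf x p) x"
  using qpoch_inf_holomorphic[OF assms]
  by (metis continuous_on_eq_continuous_at holomorphic_on_imp_continuous_on open_UNIV UNIV_I)

text \<open>Common majorant for the theta series, the weights of \<open>F8\<close> and the double
  sum. The ratio \<open>r^(2n+1) * M\<close> tends to 0, so \<open>M\<close> may be arbitrarily
  large.\<close>

lemma summable_gauss:
  fixes r M :: real
  assumes "0 \<le> r" "r < 1" "0 \<le> M"
  shows "summable (\<lambda>n. r ^ (n\<^sup>2) * M ^ n)"
proof -
  have "(\<lambda>n. (r * M) * (r ^ 2) ^ n) \<longlonglongrightarrow> r * M * 0"
    using assms by (intro tendsto_intros LIMSEQ_power_zero) (simp add: power_less_one_iff abs_square_less_1)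
  hence "eventually (\<lambda>n. (r * M) * (r ^ 2) ^ n < 1/2) sequentially"
    by (rule order_tendstoD) simp
  then obtain N where N: "\<And>n. n \<ge> N \<Longrightarrow> (r * M) * (r ^ 2) ^ n < 1/2"
    by (auto simp: eventually_sequentially)
  show ?thesis
  proof (rule summable_ratio_test[of "1/2" N])
    fix n assume "n \<ge> N"
    have "r ^ (Suc n)\<^sup>2 * M ^ Suc n = ((r * M) * (r ^ 2) ^ n) * (r ^ (n\<^sup>2) * M ^ n)"
      by (simp add: power2_eq_square power_add power_mult algebra_simps power_mult_distrib)
    also have "\<dots> \<le> 1/2 * (r ^ (n\<^sup>2) * M ^ n)"
      using N[OF \<open>n \<ge> N\<close>] assms by (intro mult_right_mono) auto
    finally show "norm (r ^ (Suc n)\<^sup>2 * M ^ Suc n) \<le> 1/2 * norm (r ^ (n\<^sup>2) * M ^ n)"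
      using assms by simp
  qed simp
qed

subsection \<open>The Jacobi triple product\<close>

lemma norm_square_less_1:
  fixes q :: complex
  assumes "norm q < 1"
  shows "norm (q\<^sup>2) < 1"
  using assms by (simp add: norm_power abs_square_less_1)

text \<open>In base \<open>q^2\<close> the power \<open>p^(a(a-1)/2)\<close> is
  \<open>q^(a^2 - a)\<close>, so the factor \<open>q ^ a\<close> completes the square, while
  \<open>qpoch\<close> cancels the denominator of \<open>euler_coeff\<close>.\<close>

lemma euler_coeff_square:
  assumes "norm q < 1"
  shows "euler_coeff (q\<^sup>2) a * qpoch (q\<^sup>2) (q\<^sup>2) a * q ^ a = (-1) ^ a * q ^ (a\<^sup>2)"
proof (induction a)
  case (Suc a)
  note q2 = norm_square_less_1[OF assms]
  have "euler_coeff (q\<^sup>2) (Suc a) * qpoch (q\<^sup>2) (q\<^sup>2) (Suc a) * q ^ Suc a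
      = (euler_coeff (q\<^sup>2) (Suc a) * (1 - (q\<^sup>2) ^ Suc a)) * qpoch (q\<^sup>2) (q\<^sup>2) a * q ^ Suc a"
    by (simp add: qpoch_Suc)
  also have "\<dots> = - ((q\<^sup>2) ^ a) * q * (euler_coeff (q\<^sup>2) a * qpoch (q\<^sup>2) (q\<^sup>2) a * q ^ a)"
    unfolding euler_coeff_Suc[OF q2] by simp
  also have "\<dots> = (-1) ^ Suc a * q ^ ((Suc a)\<^sup>2)"
    unfolding Suc by (simp add: power2_eq_square algebra_simps power_add flip: power_mult)
  finally show ?case .
qed (simp add: euler_coeff_def)

text \<open>The part \<open>n >= 0\<close> of the bilateral theta series. The part
  \<open>n <= 0\<close> is the same series at \<open>1 / w\<close>, so index 0 occurs in both
  halves.\<close>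

definition theta_term :: "complex \<Rightarrow> complex \<Rightarrow> nat \<Rightarrow> complex" where
  "theta_term q w n = (-1) ^ n * q ^ (n\<^sup>2) * w ^ n"

lemma summable_theta_term:
  assumes "norm q < 1"
  shows "summable (\<lambda>n. norm (theta_term q w n))"
  using summable_gauss[of "norm q" "norm w"] assms
  by (simp add: theta_term_def norm_mult norm_power)

text \<open>Since \<open>1 - y = - y * (1 - 1 / y)\<close>, the \<open>m\<close> factors of
  \<open>(q/z; q^2)_m\<close> turn into factors that extend \<open>(z q; q^2)_inf\<close> backwards
  to the start \<open>z q^(1-2m)\<close>. The extracted odd powers of \<open>q\<close> multiply to
  \<open>q^(m^2)\<close>.\<close>

lemma qpoch_inf_half_finite:
  assumes "q \<noteq> 0" "norm q < 1" "z \<noteq> 0"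
  shows "qpoch (q / z) (q\<^sup>2) m * qpoch_inf (z * q) (q\<^sup>2)
    = (-1) ^ m * q ^ (m\<^sup>2) / z ^ m * qpoch_inf (z * q / (q\<^sup>2) ^ m) (q\<^sup>2)"
proof (induction m)
  case (Suc m)
  note q2 = norm_square_less_1[OF assms(2)]
  have shift: "qpoch_inf (z * q / (q\<^sup>2) ^ Suc m) (q\<^sup>2)
      = (1 - z * q / (q\<^sup>2) ^ Suc m) * qpoch_inf (z * q / (q\<^sup>2) ^ m) (q\<^sup>2)"
    using qpoch_inf_shift[OF q2, of "z * q / (q\<^sup>2) ^ Suc m"] assms(1) by simp
  have coeff: "(-1) ^ Suc m * q ^ ((Suc m)\<^sup>2) / z ^ Suc m * (1 - z * q / (q\<^sup>2) ^ Suc m)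
      = (1 - q / z * (q\<^sup>2) ^ m) * ((-1) ^ m * q ^ (m\<^sup>2) / z ^ m)"
    using assms(1,3)
    by (simp add: field_simps power2_eq_square power_add power_mult_distrib)
  have "qpoch (q / z) (q\<^sup>2) (Suc m) * qpoch_inf (z * q) (q\<^sup>2)
      = (1 - q / z * (q\<^sup>2) ^ m) * (qpoch (q / z) (q\<^sup>2) m * qpoch_inf (z * q) (q\<^sup>2))"
    by (simp add: qpoch_Suc)
  also have "\<dots> = ((1 - q / z * (q\<^sup>2) ^ m) * ((-1) ^ m * q ^ (m\<^sup>2) / z ^ m))
      * qpoch_inf (z * q / (q\<^sup>2) ^ m) (q\<^sup>2)"
    unfolding Suc by (simp only: mult.assoc)
  also have "\<dots> = (-1) ^ Suc m * q ^ ((Suc m)\<^sup>2) / z ^ Suc m * qpoch_inf (z * q / (q\<^sup>2) ^ Suc m) (q\<^sup>2)"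
    unfolding shift coeff[symmetric] by (simp only: mult.assoc)
  finally show ?case .
qed simp

text \<open>The exponents of \<open>q\<close> combine to
  \<open>m^2 + a^2 - 2 m a = (a - m)^2\<close>, so \<open>u m a\<close> depends on
  \<open>a - m\<close> only. The two claims are the cases \<open>a >= m\<close> and
  \<open>a <= m\<close>, kept apart because indices are natural numbers.\<close>

lemma half_finite_term:
  assumes "q \<noteq> 0" "norm q < 1" "z \<noteq> 0"
  defines "u \<equiv> (\<lambda>m a. (-1) ^ m * q ^ (m\<^sup>2) / z ^ m * (euler_coeff (q\<^sup>2) a * (z * q / (q\<^sup>2) ^ m) ^ a)
                   * qpoch (q\<^sup>2) (q\<^sup>2) a)"
  shows "u m (m + k) = theta_term q z k" and "u (a + l) a = theta_term q (1 / z) l"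
proof -
  have u: "u m a = (-1) ^ (m + a) * q ^ (m\<^sup>2 + a\<^sup>2) * z ^ a / (z ^ m * q ^ (2 * m * a))" for m a
  proof -
    have "u m a = (-1) ^ m * q ^ (m\<^sup>2) / z ^ m * z ^ a / ((q\<^sup>2) ^ m) ^ a
        * (euler_coeff (q\<^sup>2) a * qpoch (q\<^sup>2) (q\<^sup>2) a * q ^ a)"
      unfolding u_def by (simp add: power_mult_distrib power_divide)
    also have "\<dots> = (-1) ^ (m + a) * q ^ (m\<^sup>2 + a\<^sup>2) * z ^ a / (z ^ m * q ^ (2 * m * a))"
      unfolding euler_coeff_square[OF assms(2)] by (simp add: power_add power_mult)
    finally show ?thesis .
  qed
  have "q ^ (m\<^sup>2 + (m + k)\<^sup>2) = q ^ (2 * m * (m + k)) * q ^ (k\<^sup>2)" for m k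
    unfolding power_add[symmetric] by (rule arg_cong[where f="\<lambda>n. q ^ n"]) algebra
  thus "u m (m + k) = theta_term q z k"
    unfolding u theta_term_def using assms(1,3) by (simp add: power_add flip: power_mult_distrib)
  have "q ^ ((a + l)\<^sup>2 + a\<^sup>2) = q ^ (2 * (a + l) * a) * q ^ (l\<^sup>2)" for l a
    unfolding power_add[symmetric] by (rule arg_cong[where f="\<lambda>n. q ^ n"]) algebra
  thus "u (a + l) a = theta_term q (1 / z) l"
    unfolding u theta_term_def using assms(1,3)
    by (simp add: power_add power_divide flip: power_mult_distrib)
qed

text \<open>Tannery's theorem with majorant \<open>C * norm (t n)\<close>, where \<open>C\<close>
  bounds the convergent sequence \<open>g\<close>. The alternative \<open>h n m = 0\<close> admits
  truncated sums.\<close>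

lemma suminf_tendsto_bounded_factor:
  fixes t :: "nat \<Rightarrow> complex" and g :: "nat \<Rightarrow> complex"
  assumes t: "summable (\<lambda>n. norm (t n))"
    and g: "g \<longlonglongrightarrow> 1"
    and h: "\<And>n m. norm (h n m) \<le> norm (t n) * norm (g (i n m)) \<or> h n m = 0"
    and lim: "\<And>n. h n \<longlonglongrightarrow> t n"
  shows "(\<lambda>m. \<Sum>n. h n m) \<longlonglongrightarrow> (\<Sum>n. t n)"
proof -
  obtain C where C: "C > 0" "\<And>n. norm (g n) \<le> C"
    using convergent_imp_Bseq[OF convergentI[OF g]] by (metis BseqE)
  have "norm (h n m) \<le> norm (t n) * C" for n m
    using h[of n m]
  proof
    assume "norm (h n m) \<le> norm (t n) * norm (g (i n m))"
    also have "\<dots> \<le> norm (t n) * C"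
      using C by (intro mult_left_mono) auto
    finally show ?thesis .
  qed (use C in simp)
  thus ?thesis
    using tannerys_theorem[OF lim always_eventually, where M = "\<lambda>n. norm (t n) * C"] t
    by (simp add: summable_mult2)
qed

text \<open>Euler's expansion of \<open>(z q; q\<^sup>2)\<^sub>\<infinity>\<close> gives the bilateral expansion of
  \<open>(q/z; q\<^sup>2)\<^sub>m (z q; q\<^sup>2)\<^sub>\<infinity>\<close>, truncated at \<open>k \<ge> - m\<close>; then \<open>m \<rightarrow> \<infinity>\<close>.\<close>

lemma jacobi_triple_product:
  assumes "q \<noteq> 0" "norm q < 1" "z \<noteq> 0"
  shows "qpochs_inf [z * q, q / z, q\<^sup>2] (q\<^sup>2)
    = suminf (theta_term q z) + suminf (theta_term q (1 / z)) - 1"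
proof -
  note q2 = norm_square_less_1[OF assms(2)]
  define \<Phi> where "\<Phi> = (\<lambda>x. qpoch_inf x (q\<^sup>2))"
  \<comment> \<open>\<open>g a\<close> is what remains of \<open>(q^2; q^2)_inf\<close> after its
    first \<open>a\<close> factors. It tends to 1 and, apart from the truncation, carries the whole
    dependence of the shifted summands on \<open>m\<close>.\<close>
  define g where "g = (\<lambda>a. \<Phi> ((q\<^sup>2) ^ Suc a))"
  have g_split: "qpoch (q\<^sup>2) (q\<^sup>2) a * g a = \<Phi> (q\<^sup>2)" for a
    unfolding g_def \<Phi>_def using qpoch_inf_split[OF q2, of "q\<^sup>2" a] by simp
  have "isCont \<Phi> 0"
    unfolding \<Phi>_def by (rule isCont_qpoch_inf[OF q2])
  moreover have "\<Phi> 0 = 1"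
    by (simp add: \<Phi>_def)
  moreover have "(\<lambda>a. (q\<^sup>2) ^ Suc a) \<longlonglongrightarrow> 0"
    using q2 by (intro LIMSEQ_Suc LIMSEQ_power_zero)
  ultimately have g1: "g \<longlonglongrightarrow> 1"
    unfolding g_def by (metis isCont_tendsto_compose)
  \<comment> \<open>The index \<open>a\<close> of Euler's series is \<open>m + k\<close> in
    \<open>h1\<close> and \<open>m - Suc l\<close> in \<open>h2\<close>. The cutoff
    \<open>l < m\<close> reflects that \<open>a\<close> starts at 0.\<close>
  define h1 where "h1 = (\<lambda>k m. theta_term q z k * g (m + k))"
  define h2 where "h2 = (\<lambda>l m. if l < m then theta_term q (1 / z) (Suc l) * g (m - Suc l) else 0)"
  have split: "\<Phi> (q\<^sup>2) * (qpoch (q / z) (q\<^sup>2) m * \<Phi> (z * q)) = (\<Sum>k. h1 k m) + (\<Sum>l. h2 l m)" for m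
  proof -
    define u where "u = (\<lambda>a. (-1) ^ m * q ^ (m\<^sup>2) / z ^ m * (euler_coeff (q\<^sup>2) a * (z * q / (q\<^sup>2) ^ m) ^ a)
                   * qpoch (q\<^sup>2) (q\<^sup>2) a)"
    have "(\<lambda>a. \<Phi> (q\<^sup>2) * ((-1) ^ m * q ^ (m\<^sup>2) / z ^ m * (euler_coeff (q\<^sup>2) a * (z * q / (q\<^sup>2) ^ m) ^ a)))
        sums (\<Phi> (q\<^sup>2) * (qpoch (q / z) (q\<^sup>2) m * \<Phi> (z * q)))"
      unfolding qpoch_inf_half_finite[OF assms] \<Phi>_def by (intro sums_mult qpoch_inf_sums q2)
    also have "(\<lambda>a. \<Phi> (q\<^sup>2) * ((-1) ^ m * q ^ (m\<^sup>2) / z ^ m * (euler_coeff (q\<^sup>2) a * (z * q / (q\<^sup>2) ^ m) ^ a)))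
        = (\<lambda>a. u a * g a)"
    proof
      fix a
      show "\<Phi> (q\<^sup>2) * ((-1) ^ m * q ^ (m\<^sup>2) / z ^ m * (euler_coeff (q\<^sup>2) a * (z * q / (q\<^sup>2) ^ m) ^ a))
          = u a * g a"
        unfolding u_def g_split[of a, symmetric] by (simp add: mult_ac)
    qed
    finally have sums: "(\<lambda>a. u a * g a) sums (\<Phi> (q\<^sup>2) * (qpoch (q / z) (q\<^sup>2) m * \<Phi> (z * q)))" .
    have "\<Phi> (q\<^sup>2) * (qpoch (q / z) (q\<^sup>2) m * \<Phi> (z * q))
        = (\<Sum>k. u (k + m) * g (k + m)) + (\<Sum>a<m. u a * g a)"
      using suminf_split_initial_segment[OF sums_summable[OF sums], of m] sums_unique[OF sums] by simp
    also have "(\<Sum>k. u (k + m) * g (k + m)) = (\<Sum>k. h1 k m)"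
      using half_finite_term(1)[OF assms, of m] unfolding u_def h1_def by (simp add: add.commute)
    also have "(\<Sum>a<m. u a * g a) = (\<Sum>l<m. u (m - Suc l) * g (m - Suc l))"
      by (rule sum.nat_diff_reindex[symmetric])
    also have "\<dots> = (\<Sum>l<m. h2 l m)"
    proof (rule sum.cong)
      fix l assume "l \<in> {..<m}"
      hence "m - Suc l + Suc l = m" and l: "l < m" by auto
      hence "u (m - Suc l) = theta_term q (1 / z) (Suc l)"
        using half_finite_term(2)[OF assms, of "m - Suc l" "Suc l"] unfolding u_def by metis
      thus "u (m - Suc l) * g (m - Suc l) = h2 l m"
        using l by (simp add: h2_def)
    qed simp
    also have "\<dots> = (\<Sum>l. h2 l m)"
      by (rule suminf_finite[symmetric]) (auto simp: h2_def)
    finally show ?thesis .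
  qed
  have "(\<lambda>m. \<Sum>k. h1 k m) \<longlonglongrightarrow> suminf (theta_term q z)"
  proof (rule suminf_tendsto_bounded_factor[OF summable_theta_term g1])
    show "h1 k \<longlonglongrightarrow> theta_term q z k" for k
      unfolding h1_def using tendsto_mult[OF tendsto_const LIMSEQ_ignore_initial_segment[OF g1]]
      by (metis mult.right_neutral)
  qed (use assms in \<open>auto simp: h1_def norm_mult\<close>)
  moreover have "(\<lambda>m. \<Sum>l. h2 l m) \<longlonglongrightarrow> (\<Sum>l. theta_term q (1 / z) (Suc l))"
  proof (rule suminf_tendsto_bounded_factor[OF _ g1])
    show "h2 l \<longlonglongrightarrow> theta_term q (1 / z) (Suc l)" for l
    \<comment> \<open>From \<open>m = Suc l\<close> on the cutoff is satisfied, so it disappears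
      after the shift.\<close>
    proof (rule LIMSEQ_offset)
      show "(\<lambda>m. h2 l (m + Suc l)) \<longlonglongrightarrow> theta_term q (1 / z) (Suc l)"
        unfolding h2_def using tendsto_mult[OF tendsto_const g1] by simp
    qed
    show "summable (\<lambda>l. norm (theta_term q (1 / z) (Suc l)))"
      using summable_theta_term[OF assms(2)] by (subst summable_Suc_iff)
  qed (auto simp: h2_def norm_mult)
  ultimately have "(\<lambda>m. \<Phi> (q\<^sup>2) * (qpoch (q / z) (q\<^sup>2) m * \<Phi> (z * q)))
      \<longlonglongrightarrow> suminf (theta_term q z) + (\<Sum>l. theta_term q (1 / z) (Suc l))"
    unfolding split by (rule tendsto_add)
  moreover have "(\<lambda>m. \<Phi> (q\<^sup>2) * (qpoch (q / z) (q\<^sup>2) m * \<Phi> (z * q)))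
      \<longlonglongrightarrow> \<Phi> (q\<^sup>2) * (\<Phi> (q / z) * \<Phi> (z * q))"
    unfolding \<Phi>_def by (intro tendsto_intros qpoch_LIMSEQ q2)
  ultimately have "\<Phi> (q\<^sup>2) * (\<Phi> (q / z) * \<Phi> (z * q))
      = suminf (theta_term q z) + (\<Sum>l. theta_term q (1 / z) (Suc l))"
    using LIMSEQ_unique by blast
  \<comment> \<open>The negative indices start at -1, whereas \<open>theta_term q (1 / z)\<close>
    starts at index 0 with value 1. This is the source of the \<open>- 1\<close>.\<close>
  also have "(\<Sum>l. theta_term q (1 / z) (Suc l)) = suminf (theta_term q (1 / z)) - 1"
    using suminf_split_head[OF summable_norm_cancel[OF summable_theta_term[OF assms(2), of "1 / z"]]]
    by (simp add: theta_term_def[of _ _ 0])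
  finally show ?thesis
    by (simp add: qpochs_inf_def \<Phi>_def mult_ac)
qed

subsection \<open>The series of theta tails\<close>

text \<open>The tails \<open>qpoch_inf (x * p ^ n) p\<close> tend to 1, so some tail is nonzero and
  the zero must come from the finitely many factors before it.\<close>

lemma qpoch_inf_eq_0:
  assumes "norm p < 1" "qpoch_inf x p = 0"
  obtains n where "qpoch x p (Suc n) = 0"
proof -
  have "(\<lambda>n. x * p ^ Suc n) \<longlonglongrightarrow> x * 0"
    by (intro tendsto_intros LIMSEQ_Suc LIMSEQ_power_zero assms)
  hence "(\<lambda>n. qpoch_inf (x * p ^ Suc n) p) \<longlonglongrightarrow> qpoch_inf 0 p"
    using isCont_tendsto_compose[OF isCont_qpoch_inf[OF assms(1)]] by fastforce
  hence "eventually (\<lambda>n. qpoch_inf (x * p ^ Suc n) p \<noteq> 0) sequentially"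
    by (rule tendsto_imp_eventually_ne) simp
  then obtain n where "qpoch_inf (x * p ^ Suc n) p \<noteq> 0"
    by (auto simp: eventually_sequentially)
  hence "qpoch x p (Suc n) = 0"
    using qpoch_inf_split[OF assms(1), of x "Suc n"] assms(2) by simp
  thus ?thesis by (rule that)
qed

text \<open>The \<open>T n z\<close> of the overview: \<open>(z q, q/z; q^2)_inf\<close> without the
  first \<open>n\<close> factors of each product.\<close>

definition theta_tail :: "complex \<Rightarrow> nat \<Rightarrow> complex \<Rightarrow> complex" where
  "theta_tail q n z = qpoch_inf (z * q ^ (2 * n + 1)) (q\<^sup>2) * qpoch_inf (q ^ (2 * n + 1) / z) (q\<^sup>2)"

text \<open>The bound is uniform in \<open>n\<close> because the factor \<open>q^(2n+1)\<close> only
  shrinks the arguments: they stay in the disc of radius \<open>R\<close>, where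
  \<open>qpoch_inf\<close> is bounded by compactness.\<close>

lemma theta_tail_bounded:
  assumes "norm q < 1"
  obtains B where "B > 0" "\<And>n z. \<lbrakk>norm z \<le> R; norm (1 / z) \<le> R\<rbrakk> \<Longrightarrow> norm (theta_tail q n z) \<le> B"
proof -
  have "compact ((\<lambda>x. qpoch_inf x (q\<^sup>2)) ` cball 0 R)"
    by (intro compact_continuous_image compact_cball continuous_at_imp_continuous_on ballI
        isCont_qpoch_inf norm_square_less_1 assms)
  hence "bounded ((\<lambda>x. qpoch_inf x (q\<^sup>2)) ` cball 0 R)"
    by (rule compact_imp_bounded)
  then obtain K where K: "K > 0" "\<And>x. norm x \<le> R \<Longrightarrow> norm (qpoch_inf x (q\<^sup>2)) \<le> K"
    by (auto simp: bounded_pos)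
  have "norm (theta_tail q n z) \<le> K * K" if z: "norm z \<le> R" "norm (1 / z) \<le> R" for n z
  proof -
    have shrink: "norm (x * q ^ (2 * n + 1)) \<le> R" if "norm x \<le> R" for x
    proof -
      have "norm (x * q ^ (2 * n + 1)) = norm x * norm q ^ (2 * n + 1)"
        by (simp only: norm_mult norm_power)
      also have "\<dots> \<le> norm x * 1"
        using assms by (intro mult_left_mono power_le_one) auto
      finally show ?thesis using that by simp
    qed
    have "norm (qpoch_inf (z * q ^ (2 * n + 1)) (q\<^sup>2)) \<le> K"
      using K(2)[OF shrink[OF z(1)]] .
    moreover have "norm (qpoch_inf (q ^ (2 * n + 1) / z) (q\<^sup>2)) \<le> K"
      using K(2)[OF shrink[OF z(2)]] by simp
    ultimately show ?thesis
      unfolding theta_tail_def norm_mult using K(1) by (intro mult_mono) auto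
  qed
  thus ?thesis using that K(1) by (metis mult_pos_pos)
qed

lemma theta_tail_holomorphic:
  assumes "norm q < 1"
  shows "theta_tail q n holomorphic_on - {0}"
proof -
  have "(\<lambda>x. qpoch_inf x (q\<^sup>2)) holomorphic_on f ` (- {0})" for f
    using qpoch_inf_holomorphic[OF norm_square_less_1[OF assms]] by (rule holomorphic_on_subset) simp
  hence comp: "(\<lambda>z. qpoch_inf (f z) (q\<^sup>2)) holomorphic_on - {0}" if "f holomorphic_on - {0}" for f
    using holomorphic_on_compose[OF that \<open>(\<lambda>x. qpoch_inf x (q\<^sup>2)) holomorphic_on f ` (- {0})\<close>]
    by (simp add: o_def)
  show ?thesis
    unfolding theta_tail_def by (intro holomorphic_intros comp) auto
qed

text \<open>The numerator of the \<open>n\<close>-th summand of \<open>F8\<close> is \<open>F8_weight q n * q ^ (2 * n + 1)\<close>;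
  the exponent \<open>n\<^sup>2\<close> is the one for which the functional equation telescopes.\<close>

definition F8_weight :: "complex \<Rightarrow> nat \<Rightarrow> complex" where
  "F8_weight q n = (-1) ^ n * qpoch q (q\<^sup>2) n * q ^ (n\<^sup>2)"

lemma summable_F8_weight:
  assumes "norm q < 1"
  shows "summable (\<lambda>n. norm (F8_weight q n))"
proof -
  obtain C where C: "C > 0" "\<And>n. norm (qpoch q (q\<^sup>2) n) \<le> C"
    using qpoch_bounded[OF norm_square_less_1[OF assms]] by metis
  show ?thesis
  proof (rule summable_comparison_test')
    show "summable (\<lambda>n. C * (norm q ^ (n\<^sup>2) * 1 ^ n))"
      using assms by (intro summable_mult summable_gauss) auto
    show "norm (norm (F8_weight q n)) \<le> C * (norm q ^ (n\<^sup>2) * 1 ^ n)" for n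
      using C(2)[of n] by (simp add: F8_weight_def norm_mult norm_power mult_right_mono)
  qed
qed

definition F8_series :: "complex \<Rightarrow> complex \<Rightarrow> complex" where
  "F8_series q z = (\<Sum>n. F8_weight q n * q ^ (2 * n + 1) * theta_tail q (Suc n) z)"

lemma norm_F8_series_term_le:
  assumes "norm q < 1" "norm (theta_tail q (Suc n) z) \<le> B"
  shows "norm (F8_weight q n * q ^ (2 * n + 1) * theta_tail q (Suc n) z) \<le> norm (F8_weight q n) * B"
proof -
  have "norm (F8_weight q n * q ^ (2 * n + 1) * theta_tail q (Suc n) z)
      = norm (F8_weight q n) * (norm q ^ (2 * n + 1) * norm (theta_tail q (Suc n) z))"
    by (simp only: norm_mult norm_power mult.assoc)
  also have "\<dots> \<le> norm (F8_weight q n) * (1 * B)"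
    using assms by (intro mult_left_mono mult_mono power_le_one) auto
  finally show ?thesis by simp
qed

lemma F8_series_sums:
  assumes "norm q < 1"
  shows "(\<lambda>n. F8_weight q n * q ^ (2 * n + 1) * theta_tail q (Suc n) z) sums F8_series q z"
proof -
  obtain B where B: "\<And>n. norm (theta_tail q n z) \<le> B"
    using theta_tail_bounded[OF assms, of "max (norm z) (norm (1 / z))"] by (metis max.cobounded1 max.cobounded2)
  have "summable (\<lambda>n. F8_weight q n * q ^ (2 * n + 1) * theta_tail q (Suc n) z)"
  proof (rule summable_comparison_test')
    show "summable (\<lambda>n. norm (F8_weight q n) * B)"
      by (intro summable_mult2 summable_F8_weight assms)
  qed (rule norm_F8_series_term_le[OF assms B])
  thus ?thesis
    unfolding F8_series_def by (rule summable_sums)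
qed

lemma F8_series_holomorphic:
  assumes "norm q < 1"
  shows "F8_series q holomorphic_on - {0}"
proof (rule holomorphic_uniform_sequence)
  show "open (- {0 :: complex})" by auto
  show "(\<lambda>z. \<Sum>n<m. F8_weight q n * q ^ (2 * n + 1) * theta_tail q (Suc n) z) holomorphic_on - {0}" for m
    by (intro holomorphic_intros theta_tail_holomorphic assms)
  fix x :: complex assume "x \<in> - {0}"
  hence x: "norm x > 0" by simp
  \<comment> \<open>On the disc of radius \<open>norm x / 2\<close> around \<open>x\<close>, both
    \<open>norm y\<close> and \<open>norm (1 / y)\<close> are at most \<open>R\<close>.\<close>
  define R where "R = max (2 * norm x) (2 / norm x)"
  obtain B where B: "\<And>n z. \<lbrakk>norm z \<le> R; norm (1 / z) \<le> R\<rbrakk> \<Longrightarrow> norm (theta_tail q n z) \<le> B"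
    using theta_tail_bounded[OF assms] by metis
  have cball: "norm y \<ge> norm x / 2" "norm y \<le> 2 * norm x" if "y \<in> cball x (norm x / 2)" for y
    using that norm_triangle_ineq2[of x y] norm_triangle_ineq2[of y x] x
    by (auto simp: dist_norm norm_minus_commute)
  have "uniform_limit (cball x (norm x / 2))
      (\<lambda>m z. \<Sum>n<m. F8_weight q n * q ^ (2 * n + 1) * theta_tail q (Suc n) z) (F8_series q) sequentially"
    unfolding F8_series_def
  proof (rule Weierstrass_m_test)
    show "summable (\<lambda>n. norm (F8_weight q n) * B)"
      by (intro summable_mult2 summable_F8_weight assms)
    fix n y assume y: "y \<in> cball x (norm x / 2)"
    have "norm (1 / y) \<le> 2 / norm x"
    proof -
      have "0 < norm y" using cball(1)[OF y] x by linarith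
      thus ?thesis using cball(1)[OF y] x by (simp add: norm_divide field_simps)
    qed
    hence "norm (theta_tail q (Suc n) y) \<le> B"
      using cball[OF y] by (intro B) (auto simp: R_def)
    thus "norm (F8_weight q n * q ^ (2 * n + 1) * theta_tail q (Suc n) y) \<le> norm (F8_weight q n) * B"
      by (rule norm_F8_series_term_le[OF assms])
  qed
  moreover have "cball x (norm x / 2) \<subseteq> - {0}"
    using cball x by fastforce
  ultimately show "\<exists>d>0. cball x d \<subseteq> - {0} \<and> uniform_limit (cball x d)
      (\<lambda>m z. \<Sum>n<m. F8_weight q n * q ^ (2 * n + 1) * theta_tail q (Suc n) z) (F8_series q) sequentially"
    using x by (intro exI[of _ "norm x / 2"]) auto
qed

text \<open>The infinite product divided by the denominator of the \<open>n\<close>-th summand is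
  \<open>theta_tail q (Suc n) z\<close>. The division is legitimate since, by
  \<open>qpoch_inf_eq_0\<close>, nonvanishing finite products force the infinite one to be
  nonzero.\<close>

lemma F8_eq_series:
  assumes "norm q < 1" and "\<And>n. qpochs [z * q, q / z] (q\<^sup>2) (n + 1) \<noteq> 0"
  shows "qpochs_inf [z * q, q / z, q\<^sup>2] (q\<^sup>2) * F8 z q = qpoch_inf (q\<^sup>2) (q\<^sup>2) * F8_series q z"
proof -
  note q2 = norm_square_less_1[OF assms(1)]
  define c where "c = qpoch_inf (z * q) (q\<^sup>2) * qpoch_inf (q / z) (q\<^sup>2)"
  have nz: "qpoch (z * q) (q\<^sup>2) (Suc n) \<noteq> 0" "qpoch (q / z) (q\<^sup>2) (Suc n) \<noteq> 0" for n
    using assms(2)[of n] by (auto simp: qpochs_def)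
  hence "c \<noteq> 0"
    unfolding c_def using qpoch_inf_eq_0[OF q2] by (metis mult_eq_0_iff)
  have "F8_weight q n * q ^ (2 * n + 1) * theta_tail q (Suc n) z / c
      = (-1) ^ n * qpoch q (q\<^sup>2) n * q ^ ((n + 1)\<^sup>2) / qpochs [z * q, q / z] (q\<^sup>2) (n + 1)" for n
  proof -
    have x: "q * (q\<^sup>2) ^ Suc n = q ^ (2 * Suc n + 1)"
      by (simp only: power_mult[symmetric] power_Suc[symmetric]) simp
    have "c = qpochs [z * q, q / z] (q\<^sup>2) (n + 1) * theta_tail q (Suc n) z"
      using qpoch_inf_split[OF q2, of "z * q" "Suc n"] qpoch_inf_split[OF q2, of "q / z" "Suc n"]
      unfolding c_def theta_tail_def x[symmetric] by (simp add: qpochs_def mult_ac)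
    moreover have "F8_weight q n * q ^ (2 * n + 1) = (-1) ^ n * qpoch q (q\<^sup>2) n * q ^ ((n + 1)\<^sup>2)"
      unfolding F8_weight_def by (simp add: power2_eq_square algebra_simps power_add mult_2_right)
    ultimately show ?thesis
      using \<open>c \<noteq> 0\<close> by simp
  qed
  hence "(\<lambda>n. (-1) ^ n * qpoch q (q\<^sup>2) n * q ^ ((n + 1)\<^sup>2) / qpochs [z * q, q / z] (q\<^sup>2) (n + 1))
      sums (F8_series q z / c)"
    using sums_divide[OF F8_series_sums[OF assms(1), of z], of c] by simp
  hence "F8 z q = F8_series q z / c"
    unfolding F8_def by (rule sums_unique[symmetric])
  thus ?thesis
    using \<open>c \<noteq> 0\<close> by (simp add: qpochs_inf_def c_def)
qed

lemma F8_series_telescope: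
  assumes "q \<noteq> 0" "norm q < 1" "z \<noteq> 0"
  defines "d \<equiv> (\<lambda>n. F8_weight q n * (theta_tail q n z - theta_tail q n (q\<^sup>2 * z)))"
  shows "(1 - z) * (F8_weight q n * q ^ (2 * n + 1) * theta_tail q (Suc n) z)
      + (1 - q\<^sup>2 * z) / (q\<^sup>2 * z) * (F8_weight q n * q ^ (2 * n + 1) * theta_tail q (Suc n) (q\<^sup>2 * z))
    = d n - d (Suc n)"
proof -
  define p where "p = q\<^sup>2"
  define x where "x = q ^ (2 * n + 1)"
  \<comment> \<open>\<open>a\<close> and \<open>b\<close> are the products common to all four tails.
    With these factored out and the ratio of consecutive weights equal to
    \<open>-(1 - x) * x\<close>, the claim is a rational identity in \<open>z\<close>,
    \<open>x\<close> and \<open>p\<close>.\<close>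
  define a where "a = qpoch_inf (z * x * p\<^sup>2) p"
  define b where "b = qpoch_inf (x * p / z) p"
  have p: "norm p < 1" "p \<noteq> 0"
    using norm_square_less_1[OF assms(2)] assms(1) by (simp_all add: p_def)
  have x_Suc: "q ^ (2 * Suc n + 1) = x * p"
    by (simp add: x_def p_def power_add power2_eq_square)
  have a1: "qpoch_inf (z * x * p) p = (1 - z * x * p) * a"
    using qpoch_inf_shift[OF p(1), of "z * x * p"] by (simp add: a_def power2_eq_square mult_ac)
  have a0: "qpoch_inf (z * x) p = (1 - z * x) * (1 - z * x * p) * a"
    using qpoch_inf_shift[OF p(1), of "z * x"] a1 by simp
  have b1: "qpoch_inf (x / z) p = (1 - x / z) * b"
    using qpoch_inf_shift[OF p(1), of "x / z"] by (simp add: b_def)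
  have b2: "qpoch_inf (x / (p * z)) p = (1 - x / (p * z)) * (1 - x / z) * b"
    using qpoch_inf_shift[OF p(1), of "x / (p * z)"] b1 p by simp
  have tails:
    "theta_tail q (Suc n) z = (1 - z * x * p) * a * b"
    "theta_tail q (Suc n) (p * z) = a * ((1 - x / z) * b)"
    "theta_tail q n z = (1 - z * x) * (1 - z * x * p) * a * ((1 - x / z) * b)"
    "theta_tail q n (p * z) = (1 - z * x * p) * a * ((1 - x / (p * z)) * (1 - x / z) * b)"
    unfolding theta_tail_def x_Suc x_def[symmetric] p_def[symmetric]
    using a0 a1 b1 b2 p by (simp_all add: a_def b_def power2_eq_square mult_ac)
  have weight: "F8_weight q (Suc n) = - F8_weight q n * (1 - x) * x"
    unfolding F8_weight_def qpoch_Suc x_def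
    by (simp add: power2_eq_square algebra_simps power_add mult_2_right power_mult_distrib)
  show ?thesis
    unfolding d_def weight x_def[symmetric] p_def[symmetric] tails
    using p(2) assms(3) by (simp add: field_simps)
qed

text \<open>Summing \<open>F8_series_telescope\<close> leaves only \<open>d 0\<close>: the weights
  are summable and the tails bounded, so \<open>d n\<close> tends to 0.\<close>

lemma F8_series_functional_equation:
  assumes "q \<noteq> 0" "norm q < 1" "z \<noteq> 0"
  shows "(1 - z) * F8_series q z + (1 - q\<^sup>2 * z) / (q\<^sup>2 * z) * F8_series q (q\<^sup>2 * z)
    = theta_tail q 0 z - theta_tail q 0 (q\<^sup>2 * z)"
proof -
  define d where "d = (\<lambda>n. F8_weight q n * (theta_tail q n z - theta_tail q n (q\<^sup>2 * z)))"
  obtain B where B: "\<And>n. norm (theta_tail q n z) \<le> B"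
    using theta_tail_bounded[OF assms(2), of "max (norm z) (norm (1 / z))"] by (metis max.cobounded1 max.cobounded2)
  obtain B' where B': "\<And>n. norm (theta_tail q n (q\<^sup>2 * z)) \<le> B'"
    using theta_tail_bounded[OF assms(2), of "max (norm (q\<^sup>2 * z)) (norm (1 / (q\<^sup>2 * z)))"]
    by (metis max.cobounded1 max.cobounded2)
  have "norm (d n) \<le> norm (F8_weight q n) * (B + B')" for n
    unfolding d_def norm_mult
    by (intro mult_left_mono order_trans[OF norm_triangle_ineq4] add_mono B B') auto
  hence "summable d"
    by (intro summable_comparison_test'[OF summable_mult2[OF summable_F8_weight[OF assms(2)]]])
  hence "(\<lambda>n. d n - d (Suc n)) sums (d 0 - 0)"
    by (intro telescope_sums' summable_LIMSEQ_zero)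
  moreover have "(\<lambda>n. d n - d (Suc n)) sums
      ((1 - z) * F8_series q z + (1 - q\<^sup>2 * z) / (q\<^sup>2 * z) * F8_series q (q\<^sup>2 * z))"
    unfolding d_def F8_series_telescope[OF assms, symmetric]
    by (intro sums_add sums_mult F8_series_sums assms)
  moreover have "d 0 = theta_tail q 0 z - theta_tail q 0 (q\<^sup>2 * z)"
    by (simp add: d_def F8_weight_def)
  ultimately show ?thesis
    using sums_unique2 by fastforce
qed

subsection \<open>Quasi-periodic holomorphic functions\<close>

text \<open>A bound on the annulus \<open>r <= norm z <= 1 / r\<close> spreads over the punctured
  plane without loss. Inside, \<open>f z = - z * f (z / p)\<close> with \<open>norm z < 1\<close>;
  outside, \<open>f (p * z) = - p * z * f z\<close> with \<open>norm (p * z) >= 1\<close>.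
  Liouville's theorem then makes \<open>f\<close> constant.\<close>

lemma quasi_periodic_eq_0:
  fixes p :: complex
  assumes "p \<noteq> 0" "norm p < 1" and holo: "f holomorphic_on - {0}"
    and quasi: "\<And>z. z \<noteq> 0 \<Longrightarrow> f (p * z) = - p * z * f z"
    and "z \<noteq> 0"
  shows "f z = 0"
proof -
  define r where "r = norm p"
  have r: "0 < r" "r < 1" using assms by (auto simp: r_def)
  define K where "K = cball 0 (1 / r) - ball (0::complex) r"
  have "compact K"
    unfolding K_def by (intro compact_diff compact_cball open_ball)
  moreover have "K \<subseteq> - {0}" using r by (auto simp: K_def)
  ultimately have "bounded (f ` K)"
    by (intro compact_imp_bounded compact_continuous_image holomorphic_on_imp_continuous_on
        holomorphic_on_subset[OF holo])
  then obtain B where B: "\<And>z. r \<le> norm z \<Longrightarrow> norm z \<le> 1 / r \<Longrightarrow> norm (f z) \<le> B"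
    unfolding bounded_iff K_def by force
  have annulus: "norm (f z) \<le> B" if "r ^ Suc n \<le> norm z" "norm z \<le> 1 / r ^ Suc n" for n z
    using that
  proof (induction n arbitrary: z)
    case 0
    thus ?case using B by simp
  next
    case (Suc n)
    have z: "norm z > 0"
      using Suc.prems(1) r(1) by (meson less_le_trans zero_less_power)
    consider "norm z < r" | "norm z > 1 / r" | "r \<le> norm z" "norm z \<le> 1 / r" by linarith
    thus ?case
    proof cases
      case 1
      have "norm (z / p) = norm z / r" by (simp add: norm_divide r_def)
      moreover have "r ^ Suc n \<le> norm z / r" using Suc.prems(1) r by (simp add: field_simps)
      moreover have "norm z / r \<le> 1" using 1 r by simp
      moreover have "1 \<le> 1 / r ^ Suc n" using r by (simp add: power_le_one del: power_Suc)
      ultimately have IH: "norm (f (z / p)) \<le> B" by (intro Suc.IH) auto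
      have "norm (f z) = norm z * norm (f (z / p))"
        using quasi[of "z / p"] z \<open>p \<noteq> 0\<close> by (simp add: norm_mult)
      also have "\<dots> \<le> 1 * norm (f (z / p))"
        using 1 r by (intro mult_right_mono) auto
      finally show ?thesis using IH by simp
    next
      case 2
      have pz: "norm (p * z) = r * norm z" by (simp add: norm_mult r_def)
      have ge: "r * norm z \<ge> 1" using 2 r by (simp add: field_simps)
      have "r * norm z \<le> 1 / r ^ Suc n"
        using Suc.prems(2) r by (simp add: field_simps)
      moreover have "r ^ Suc n \<le> 1" using r by (intro power_le_one) auto
      ultimately have IH: "norm (f (p * z)) \<le> B"
        using ge pz by (intro Suc.IH) auto
      have "1 * norm (f z) \<le> norm (p * z) * norm (f z)"
        using ge pz by (intro mult_right_mono) auto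
      also have "\<dots> = norm (f (p * z))"
        using quasi[of z] z by (simp add: norm_mult)
      finally show ?thesis using IH by simp
    qed (rule B)
  qed
  have bound: "norm (f z) \<le> B" if z: "z \<noteq> 0" for z
  proof -
    have "(\<lambda>n. r ^ Suc n) \<longlonglongrightarrow> 0"
      using r by (intro LIMSEQ_Suc LIMSEQ_power_zero) simp
    hence "eventually (\<lambda>n. r ^ Suc n < min (norm z) (1 / norm z)) sequentially"
      using z by (intro order_tendstoD) auto
    then obtain n where "r ^ Suc n < min (norm z) (1 / norm z)"
      by (auto simp: eventually_sequentially)
    thus ?thesis
      using z r by (intro annulus[of n]) (auto simp: field_simps)
  qed
  have "(\<lambda>w. f (exp w)) holomorphic_on UNIV"
  proof -
    have "f holomorphic_on range exp"
      using holo by (rule holomorphic_on_subset) auto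
    thus ?thesis
      using holomorphic_on_compose[OF holomorphic_on_exp] by (simp add: o_def)
  qed
  moreover have "bounded (range (\<lambda>w. f (exp w)))"
    unfolding bounded_iff using bound by (intro exI[of _ B]) auto
  ultimately have "(\<lambda>w. f (exp w)) constant_on UNIV"
    by (rule Liouville_theorem)
  then obtain c where c: "\<And>w. f (exp w) = c"
    unfolding constant_on_def by blast
  have "f z = c" if "z \<noteq> 0" for z
    using c[of "ln z"] that by simp
  \<comment> \<open>Quasi-periodicity at \<open>z = 1\<close>; as \<open>norm p < 1\<close> excludes
    \<open>p = -1\<close>, the constant vanishes.\<close>
  hence "c = - p * c"
    using quasi[of 1] \<open>p \<noteq> 0\<close> by simp
  hence "c * (1 + p) = 0"
    by algebra
  moreover have "p \<noteq> - 1" using \<open>norm p < 1\<close> by auto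
  ultimately have "c = 0"
    by (metis add.commute add_eq_0_iff mult_eq_0_iff)
  thus ?thesis
    using \<open>\<And>z. z \<noteq> 0 \<Longrightarrow> f z = c\<close> \<open>z \<noteq> 0\<close> by simp
qed

subsection \<open>The Hecke-type double sum\<close>

lemma summable_on_gauss_int:
  fixes r M :: real
  assumes "0 \<le> r" "r < 1" "0 \<le> M"
  shows "(\<lambda>n::int. r ^ ((nat \<bar>n\<bar>)\<^sup>2) * M ^ nat \<bar>n\<bar>) summable_on UNIV"
proof -
  let ?h = "\<lambda>n::int. r ^ ((nat \<bar>n\<bar>)\<^sup>2) * M ^ nat \<bar>n\<bar>"
  have nat: "(\<lambda>n. r ^ (n\<^sup>2) * M ^ n) summable_on UNIV"
    using summable_gauss[OF assms] assms by (intro norm_summable_imp_summable_on) simp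
  have "?h summable_on range int" "?h summable_on range (\<lambda>n. - int n)"
    using nat by (subst summable_on_reindex; simp add: inj_on_def o_def)+
  hence "?h summable_on (range int \<union> range (\<lambda>n. - int n))"
    by (rule summable_on_union)
  also have "range int \<union> range (\<lambda>n. - int n) = UNIV"
  proof -
    have "n \<in> range int \<union> range (\<lambda>n. - int n)" for n
      by (cases n rule: int_cases2) auto
    thus ?thesis by blast
  qed
  finally show ?thesis .
qed

lemma norm_sg [simp]: "norm (sg n) = 1"
  by (simp add: sg_def)

lemma norm_power_int_le:
  fixes q :: complex
  assumes "q \<noteq> 0" "norm q < 1" "int m \<le> e"
  shows "norm (q powi e) \<le> norm q ^ m"
  using power_int_decreasing[of "int m" e "norm q"] assms by (simp add: norm_power_int)

text \<open>The index \<open>k\<close> is \<open>j - 1\<close> in the notation of the theorem.\<close>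

definition hecke_term :: "complex \<Rightarrow> complex \<Rightarrow> nat \<times> int \<Rightarrow> complex" where
  "hecke_term q w = (\<lambda>(k, n). (-1) ^ k * sg n * q powi (2 * n\<^sup>2 - n - (int k)\<^sup>2 - int k) * w ^ k)"

text \<open>With \<open>k = j - 1\<close> the range \<open>1 <= j <= |n|\<close> becomes
  \<open>|n| > k\<close>. Placing \<open>k\<close> outermost lets the double sum be read as a power
  series in \<open>w\<close>.\<close>

abbreviation hecke_cone :: "(nat \<times> int) set" where
  "hecke_cone \<equiv> Sigma UNIV (\<lambda>k. {n. \<bar>n\<bar> > int k})"

text \<open>On the cone \<open>k (k + 1) <= |n| (|n| - 1) <= n^2 - n\<close>, so the exponent of
  \<open>q\<close> is at least \<open>n^2\<close>. With \<open>r\<close> the square root of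
  \<open>norm q\<close>, one of the two factors \<open>r^(n^2)\<close> is weakened to
  \<open>r^(k^2)\<close>, and \<open>norm w ^ k <= M ^ |n|\<close>. The majorant is thus a product
  of a function of \<open>k\<close> and a function of \<open>n\<close>.\<close>

lemma abs_summable_hecke:
  assumes "q \<noteq> 0" "norm q < 1"
  shows "(\<lambda>x. norm (hecke_term q w x)) summable_on hecke_cone"
proof -
  define r where "r = sqrt (norm q)"
  define M where "M = max 1 (norm w)"
  have r: "0 \<le> r" "r < 1" "norm q = r\<^sup>2" using assms by (auto simp: r_def)
  have M: "0 \<le> M" "1 \<le> M" "norm w \<le> M" by (auto simp: M_def)
  define b where "b = (\<lambda>n. r ^ ((nat \<bar>n\<bar>)\<^sup>2) * M ^ nat \<bar>n\<bar>)"
  define g where "g = (\<lambda>(k::nat, n::int). r ^ (k\<^sup>2) * b n)"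
  have norm_g: "norm (g (k, n)) = r ^ (k\<^sup>2) * b n" for k n
    using r(1) M(1) by (simp add: g_def b_def abs_mult)
  have a_summable: "(\<lambda>k. r ^ (k\<^sup>2)) summable_on UNIV"
    using summable_gauss[of r 1] r by (intro norm_summable_imp_summable_on) simp
  have b_summable: "b summable_on UNIV"
    unfolding b_def by (rule summable_on_gauss_int[OF r(1,2) M(1)])
  have "(\<lambda>n. norm (g (k, n))) summable_on UNIV" for k
    unfolding norm_g by (rule summable_on_cmult_right[OF b_summable])
  moreover have "(\<lambda>k. norm (\<Sum>\<^sub>\<infinity>n. norm (g (k, n)))) summable_on UNIV"
  proof -
    have "norm (\<Sum>\<^sub>\<infinity>n. norm (g (k, n))) = r ^ (k\<^sup>2) * norm (infsum b UNIV)" for k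
      using r(1) unfolding norm_g infsum_cmult_right' norm_mult by simp
    thus ?thesis
      by (simp only: summable_on_cmult_left[OF a_summable])
  qed
  ultimately have "(\<lambda>x. norm (g x)) summable_on UNIV \<times> UNIV"
    unfolding Infinite_Sum.abs_summable_on_Sigma_iff by blast
  hence "(\<lambda>x. norm (g x)) summable_on hecke_cone"
    by (rule summable_on_subset_banach) auto
  thus ?thesis
  proof (rule Infinite_Sum.abs_summable_on_comparison_test)
    fix x assume "x \<in> hecke_cone"
    then obtain k n where x: "x = (k, n)" and kn: "\<bar>n\<bar> > int k" by auto
    define N where "N = nat \<bar>n\<bar>"
    have N: "k < N" "int N = \<bar>n\<bar>" using kn by (auto simp: N_def)
    have "int (N\<^sup>2) \<le> 2 * n\<^sup>2 - n - (int k)\<^sup>2 - int k"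
    proof -
      have "(int k + 1) * int k \<le> \<bar>n\<bar> * (\<bar>n\<bar> - 1)"
        using kn by (intro mult_mono) auto
      moreover have "\<bar>n\<bar> * (\<bar>n\<bar> - 1) \<le> n\<^sup>2 - n"
        by (cases "n \<ge> 0") (auto simp: power2_eq_square algebra_simps)
      moreover have "int (N\<^sup>2) = n\<^sup>2"
        using N(2) by simp
      ultimately show ?thesis
        by (simp add: power2_eq_square algebra_simps)
    qed
    hence "norm (q powi (2 * n\<^sup>2 - n - (int k)\<^sup>2 - int k)) \<le> norm q ^ (N\<^sup>2)"
      by (rule norm_power_int_le[OF assms])
    also have "\<dots> = r ^ (N\<^sup>2) * r ^ (N\<^sup>2)"
      by (simp add: r(3) power2_eq_square power_mult_distrib)
    also have "\<dots> \<le> r ^ (k\<^sup>2) * r ^ (N\<^sup>2)"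
      using r(1,2) N(1) by (intro mult_right_mono power_decreasing power_mono) auto
    finally have 1: "norm (q powi (2 * n\<^sup>2 - n - (int k)\<^sup>2 - int k)) \<le> r ^ (k\<^sup>2) * r ^ (N\<^sup>2)" .
    have "norm w ^ k \<le> M ^ k" using M by (intro power_mono) auto
    also have "\<dots> \<le> M ^ N" using M(2) N(1) by (intro power_increasing) auto
    finally have 2: "norm w ^ k \<le> M ^ N" .
    have "norm (hecke_term q w x) = norm (q powi (2 * n\<^sup>2 - n - (int k)\<^sup>2 - int k)) * norm w ^ k"
      by (simp add: hecke_term_def x norm_mult norm_power)
    also have "\<dots> \<le> (r ^ (k\<^sup>2) * r ^ (N\<^sup>2)) * M ^ N"
      using 1 2 r(1) by (intro mult_mono) auto
    also have "\<dots> = norm (g x)"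
      unfolding x norm_g by (simp add: b_def N_def)
    finally show "norm (hecke_term q w x) \<le> norm (g x)" .
  qed
qed

text \<open>The inner sum of the double sum once the factors depending on \<open>k\<close> alone are
  taken out; \<open>sg\<close> makes it the tail of a false theta series.\<close>

definition false_theta_tail :: "complex \<Rightarrow> nat \<Rightarrow> complex" where
  "false_theta_tail q k = (\<Sum>\<^sub>\<infinity>n\<in>{n. \<bar>n\<bar> > int k}. sg n * q powi (2 * n\<^sup>2 - n))"

lemma false_theta_summable:
  assumes "q \<noteq> 0" "norm q < 1"
  shows "(\<lambda>n. sg n * q powi (2 * n\<^sup>2 - n)) summable_on A"
proof -
  have "(\<lambda>n::int. norm (norm q ^ ((nat \<bar>n\<bar>)\<^sup>2) * 1 ^ nat \<bar>n\<bar>)) summable_on UNIV"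
    using summable_on_gauss_int[of "norm q" 1] assms by simp
  hence "(\<lambda>n. norm (sg n * q powi (2 * n\<^sup>2 - n))) summable_on UNIV"
  proof (rule Infinite_Sum.abs_summable_on_comparison_test)
    fix n :: int
    have "n \<le> n\<^sup>2"
    proof (cases "n \<ge> 1")
      case True
      thus ?thesis using mult_left_mono[of 1 n n] by (simp add: power2_eq_square)
    next
      case False
      thus ?thesis using zero_le_power2[of n] by linarith
    qed
    hence "int ((nat \<bar>n\<bar>)\<^sup>2) \<le> 2 * n\<^sup>2 - n" by simp
    from norm_power_int_le[OF assms this]
    show "norm (sg n * q powi (2 * n\<^sup>2 - n)) \<le> norm (norm q ^ ((nat \<bar>n\<bar>)\<^sup>2) * 1 ^ nat \<bar>n\<bar>)"
      by (simp add: norm_mult)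
  qed
  hence "(\<lambda>n. sg n * q powi (2 * n\<^sup>2 - n)) summable_on UNIV"
    by (rule Infinite_Sum.abs_summable_summable)
  thus ?thesis by (rule summable_on_subset_banach) simp
qed

text \<open>Only the indices \<open>n = k + 1\<close> and \<open>n = -(k + 1)\<close> are split off.
  Their exponents are written around \<open>k^2 + k\<close> because \<open>hecke_coeff\<close>
  divides by that power of \<open>q\<close>.\<close>

lemma false_theta_tail_Suc:
  assumes "q \<noteq> 0" "norm q < 1"
  shows "false_theta_tail q k
    = q ^ ((Suc k)\<^sup>2) * q ^ (k\<^sup>2 + k) * (1 - q ^ (2 * Suc k)) + false_theta_tail q (Suc k)"
proof -
  let ?f = "\<lambda>n. sg n * q powi (2 * n\<^sup>2 - n)"
  define m where "m = int (Suc k)"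
  have "{n. \<bar>n\<bar> > int k} = insert m (insert (- m) {n. \<bar>n\<bar> > int (Suc k)})"
    by (auto simp: m_def)
  hence "false_theta_tail q k = infsum ?f (insert m (insert (- m) {n. \<bar>n\<bar> > int (Suc k)}))"
    by (simp only: false_theta_tail_def)
  also have "\<dots> = ?f m + infsum ?f (insert (- m) {n. \<bar>n\<bar> > int (Suc k)})"
    by (rule infsum_insert[OF false_theta_summable[OF assms]]) (auto simp: m_def)
  also have "infsum ?f (insert (- m) {n. \<bar>n\<bar> > int (Suc k)}) = ?f (- m) + infsum ?f {n. \<bar>n\<bar> > int (Suc k)}"
    by (rule infsum_insert[OF false_theta_summable[OF assms]]) (auto simp: m_def)
  also have "infsum ?f {n. \<bar>n\<bar> > int (Suc k)} = false_theta_tail q (Suc k)"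
    by (simp only: false_theta_tail_def)
  also have "?f m = q ^ ((Suc k)\<^sup>2 + (k\<^sup>2 + k))"
  proof -
    have "2 * m\<^sup>2 - m = int ((Suc k)\<^sup>2 + (k\<^sup>2 + k))"
      by (simp add: m_def power2_eq_square algebra_simps)
    hence "q powi (2 * m\<^sup>2 - m) = q ^ ((Suc k)\<^sup>2 + (k\<^sup>2 + k))"
      by (simp only: power_int_of_nat)
    thus ?thesis by (simp add: sg_def m_def)
  qed
  also have "?f (- m) = - (q ^ ((Suc k)\<^sup>2 + (k\<^sup>2 + k) + 2 * Suc k))"
  proof -
    have "2 * (- m)\<^sup>2 - (- m) = int ((Suc k)\<^sup>2 + (k\<^sup>2 + k) + 2 * Suc k)"
      by (simp add: m_def power2_eq_square algebra_simps)
    hence "q powi (2 * (- m)\<^sup>2 - (- m)) = q ^ ((Suc k)\<^sup>2 + (k\<^sup>2 + k) + 2 * Suc k)"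
      by (simp only: power_int_of_nat)
    thus ?thesis by (simp add: sg_def m_def)
  qed
  finally show ?thesis by (simp only: power_add ring_distribs mult_1_right) simp
qed

definition hecke_coeff :: "complex \<Rightarrow> nat \<Rightarrow> complex" where
  "hecke_coeff q k = (-1) ^ k / q ^ (k\<^sup>2 + k) * false_theta_tail q k"

text \<open>The recurrence of \<open>false_theta_tail\<close> after rescaling. Multiplied by
  \<open>w ^ Suc k\<close>, its inhomogeneous part is a theta term at \<open>q^2 * w\<close> minus
  one at \<open>w\<close>, which ties the double sum to the theta function.\<close>

lemma hecke_coeff_Suc:
  assumes "q \<noteq> 0" "norm q < 1"
  shows "hecke_coeff q (Suc k) * (q\<^sup>2) ^ Suc k
    = - hecke_coeff q k + (-1) ^ k * q ^ ((Suc k)\<^sup>2) * (1 - (q\<^sup>2) ^ Suc k)"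
proof -
  define A B e where "A = q ^ (k\<^sup>2 + k)" and "B = (q\<^sup>2) ^ Suc k" and "e = (-1 :: complex) ^ k"
  have "A \<noteq> 0" "B \<noteq> 0" using assms(1) by (simp_all add: A_def B_def)
  have Suc: "q ^ ((Suc k)\<^sup>2 + Suc k) = A * B"
  proof -
    have "(Suc k)\<^sup>2 + Suc k = (k\<^sup>2 + k) + 2 * Suc k"
      by (simp add: power2_eq_square)
    thus ?thesis by (simp only: A_def B_def power_add power_mult)
  qed
  have tail: "false_theta_tail q k = q ^ ((Suc k)\<^sup>2) * A * (1 - B) + false_theta_tail q (Suc k)"
    unfolding false_theta_tail_Suc[OF assms, of k] A_def B_def by (simp only: power_mult)
  have sign: "(-1 :: complex) ^ Suc k = - e" by (simp add: e_def)
  have "- e / (A * B) * t * B = - (e / A * (s * A * (1 - B) + t)) + e * s * (1 - B)" for s t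
    using \<open>A \<noteq> 0\<close> \<open>B \<noteq> 0\<close> by (simp add: field_simps)
  thus ?thesis
    unfolding hecke_coeff_def Suc sign tail unfolding A_def[symmetric] B_def[symmetric] e_def[symmetric] .
qed

definition hecke_sum :: "complex \<Rightarrow> complex \<Rightarrow> complex" where
  "hecke_sum q w = infsum (hecke_term q w) hecke_cone"

lemma hecke_has_sum:
  assumes "q \<noteq> 0" "norm q < 1"
  shows "(hecke_term q w has_sum hecke_sum q w) hecke_cone"
  unfolding hecke_sum_def by (rule has_sum_infsum[OF Infinite_Sum.abs_summable_summable[OF abs_summable_hecke[OF assms]]])

text \<open>Absolute convergence permits summing over \<open>n\<close> first. The outcome is a power
  series converging everywhere, so \<open>hecke_sum q\<close> is entire.\<close>

lemma hecke_sums: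
  assumes "q \<noteq> 0" "norm q < 1"
  shows "(\<lambda>k. hecke_coeff q k * w ^ k) sums hecke_sum q w"
proof -
  have "((\<lambda>n. hecke_term q w (k, n)) has_sum (hecke_coeff q k * w ^ k)) {n. \<bar>n\<bar> > int k}" for k
  proof -
    have "q powi (2 * n\<^sup>2 - n - (int k)\<^sup>2 - int k) = q powi (2 * n\<^sup>2 - n) / q ^ (k\<^sup>2 + k)" for n
    proof -
      have "2 * n\<^sup>2 - n - (int k)\<^sup>2 - int k = (2 * n\<^sup>2 - n) - int (k\<^sup>2 + k)" by simp
      moreover have "q powi ((2 * n\<^sup>2 - n) - int (k\<^sup>2 + k))
          = q powi (2 * n\<^sup>2 - n) / q powi int (k\<^sup>2 + k)"
        using assms(1) by (intro power_int_diff) simp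
      ultimately show ?thesis by (simp only: power_int_of_nat)
    qed
    hence "hecke_term q w (k, n)
        = ((-1) ^ k / q ^ (k\<^sup>2 + k) * w ^ k) * (sg n * q powi (2 * n\<^sup>2 - n))" for n
      by (simp add: hecke_term_def)
    moreover have "((\<lambda>n. ((-1) ^ k / q ^ (k\<^sup>2 + k) * w ^ k) * (sg n * q powi (2 * n\<^sup>2 - n)))
        has_sum (((-1) ^ k / q ^ (k\<^sup>2 + k) * w ^ k) * false_theta_tail q k)) {n. \<bar>n\<bar> > int k}"
      unfolding false_theta_tail_def
      by (intro has_sum_cmult_right has_sum_infsum false_theta_summable assms)
    moreover have "(-1) ^ k / q ^ (k\<^sup>2 + k) * w ^ k * false_theta_tail q k = hecke_coeff q k * w ^ k"
      by (simp add: hecke_coeff_def)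
    ultimately show ?thesis by (simp only:)
  qed
  from has_sum_SigmaD[OF hecke_has_sum[OF assms] this] show ?thesis
    by (rule has_sum_imp_sums)
qed

text \<open>\<open>hecke_coeff_Suc\<close> multiplied by \<open>w ^ Suc k\<close> and summed over
  \<open>k\<close>. The recurrence reaches only indices from 1 on, so \<open>hecke_coeff q 0\<close>
  appears separately.\<close>

lemma hecke_sum_shift:
  assumes "q \<noteq> 0" "norm q < 1"
  shows "hecke_sum q (q\<^sup>2 * w)
    = hecke_coeff q 0 - w * hecke_sum q w - suminf (theta_term q w) + suminf (theta_term q (q\<^sup>2 * w))"
proof -
  have theta: "(\<lambda>k. theta_term q w (Suc k)) sums (suminf (theta_term q w) - 1)" for w
  proof -
    have "theta_term q w sums suminf (theta_term q w)"
      by (rule summable_sums[OF summable_norm_cancel[OF summable_theta_term[OF assms(2)]]])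
    moreover have "theta_term q w 0 = 1" by (simp add: theta_term_def)
    ultimately show ?thesis
      using sums_Suc_iff[of "theta_term q w" "suminf (theta_term q w) - 1"] by simp
  qed
  have "(\<lambda>k. - w * (hecke_coeff q k * w ^ k) - theta_term q w (Suc k) + theta_term q (q\<^sup>2 * w) (Suc k))
      sums (- w * hecke_sum q w - (suminf (theta_term q w) - 1) + (suminf (theta_term q (q\<^sup>2 * w)) - 1))"
    by (rule sums_add[OF sums_diff[OF sums_mult[OF hecke_sums[OF assms]] theta] theta])
  moreover have "- w * (hecke_coeff q k * w ^ k) - theta_term q w (Suc k) + theta_term q (q\<^sup>2 * w) (Suc k)
      = hecke_coeff q (Suc k) * (q\<^sup>2 * w) ^ Suc k" for k
  proof -
    have "hecke_coeff q (Suc k) * (q\<^sup>2 * w) ^ Suc k = (hecke_coeff q (Suc k) * (q\<^sup>2) ^ Suc k) * w ^ Suc k"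
      by (simp only: power_mult_distrib mult.assoc)
    thus ?thesis
      unfolding hecke_coeff_Suc[OF assms] theta_term_def power_mult_distrib
      by (simp add: algebra_simps)
  qed
  ultimately have "(\<lambda>k. hecke_coeff q (Suc k) * (q\<^sup>2 * w) ^ Suc k)
      sums (- w * hecke_sum q w - (suminf (theta_term q w) - 1) + (suminf (theta_term q (q\<^sup>2 * w)) - 1))"
    by (simp only:)
  hence "(\<lambda>k. hecke_coeff q k * (q\<^sup>2 * w) ^ k)
      sums (- w * hecke_sum q w - (suminf (theta_term q w) - 1) + (suminf (theta_term q (q\<^sup>2 * w)) - 1)
        + hecke_coeff q 0)"
    by (subst (asm) sums_Suc_iff) simp
  hence "- w * hecke_sum q w - (suminf (theta_term q w) - 1) + (suminf (theta_term q (q\<^sup>2 * w)) - 1)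
        + hecke_coeff q 0 = hecke_sum q (q\<^sup>2 * w)"
    using hecke_sums[OF assms] by (rule sums_unique2)
  from this[symmetric] show ?thesis by simp
qed

section \<open>Comparison of the two sides\<close>

lemma F8_series_eq_hecke:
  assumes "q \<noteq> 0" "norm q < 1" "z \<noteq> 0"
  shows "qpoch_inf (q\<^sup>2) (q\<^sup>2) * ((1 - z) * F8_series q z) = hecke_sum q (1 / z) - z * hecke_sum q z"
proof -
  \<comment> \<open>The difference \<open>E\<close> of the overview; the aim is to verify the
    hypotheses of \<open>quasi_periodic_eq_0\<close> with \<open>p = q^2\<close>.\<close>
  define f where "f = (\<lambda>z. qpoch_inf (q\<^sup>2) (q\<^sup>2) * ((1 - z) * F8_series q z)
      - (hecke_sum q (1 / z) - z * hecke_sum q z))"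
  have "hecke_sum q holomorphic_on UNIV"
    using hecke_sums[OF assms(1,2)] by (rule entire_power_series)
  hence hecke: "hecke_sum q holomorphic_on A" for A
    by (rule holomorphic_on_subset) simp
  have inv: "(\<lambda>z. hecke_sum q (1 / z)) holomorphic_on - {0}"
  proof -
    have "(\<lambda>z::complex. 1 / z) holomorphic_on - {0}"
      by (intro holomorphic_intros) auto
    from holomorphic_on_compose[OF this hecke] show ?thesis by (simp add: o_def)
  qed
  have holo: "f holomorphic_on - {0}"
    unfolding f_def
    by (intro holomorphic_on_diff holomorphic_on_mult holomorphic_on_const holomorphic_on_ident
        inv hecke F8_series_holomorphic assms(2))
  have quasi: "f (q\<^sup>2 * z) = - (q\<^sup>2) * z * f z" if z: "z \<noteq> 0" for z
  proof -
    define p where "p = q\<^sup>2"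
    have p: "p \<noteq> 0" using assms(1) by (simp add: p_def)
    have theta: "qpoch_inf p p * theta_tail q 0 y
        = suminf (theta_term q y) + suminf (theta_term q (1 / y)) - 1" if "y \<noteq> 0" for y
      using jacobi_triple_product[OF assms(1,2) that]
      by (simp add: theta_tail_def qpochs_inf_def p_def mult_ac)
    have eq: "(1 - p * z) * F8_series q (p * z)
        = p * z * (theta_tail q 0 z - theta_tail q 0 (p * z) - (1 - z) * F8_series q z)"
      using F8_series_functional_equation[OF assms(1,2) z] p z
      unfolding p_def[symmetric] by (simp add: field_simps)
    have "qpoch_inf p p * ((1 - p * z) * F8_series q (p * z))
        = p * z * (qpoch_inf p p * theta_tail q 0 z - qpoch_inf p p * theta_tail q 0 (p * z)
            - qpoch_inf p p * ((1 - z) * F8_series q z))"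
      unfolding eq by (simp add: algebra_simps)
    hence lhs: "qpoch_inf p p * ((1 - p * z) * F8_series q (p * z))
        = p * z * ((suminf (theta_term q z) + suminf (theta_term q (1 / z)) - 1)
            - (suminf (theta_term q (p * z)) + suminf (theta_term q (1 / (p * z))) - 1)
            - qpoch_inf p p * ((1 - z) * F8_series q z))"
      using theta[of z] theta[of "p * z"] p z by simp
    have shift: "hecke_sum q (p * z)
        = hecke_coeff q 0 - z * hecke_sum q z - suminf (theta_term q z) + suminf (theta_term q (p * z))"
      unfolding p_def by (rule hecke_sum_shift[OF assms(1,2)])
    \<comment> \<open>Here the shift is taken at \<open>w = 1 / (p * z)\<close>, so that
      \<open>q^2 * w = 1 / z\<close>; it is then solved for the value at \<open>w\<close>.\<close>
    have "hecke_sum q (1 / z) = hecke_coeff q 0 - 1 / (p * z) * hecke_sum q (1 / (p * z))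
        - suminf (theta_term q (1 / (p * z))) + suminf (theta_term q (1 / z))"
      using hecke_sum_shift[OF assms(1,2), of "1 / (p * z)"] p unfolding p_def[symmetric] by simp
    hence shift': "hecke_sum q (1 / (p * z)) = p * z * (hecke_coeff q 0 - hecke_sum q (1 / z)
        - suminf (theta_term q (1 / (p * z))) + suminf (theta_term q (1 / z)))"
      using p z by (simp add: field_simps)
    \<comment> \<open>All theta series and both constants \<open>hecke_coeff q 0\<close>
      cancel.\<close>
    show ?thesis
      unfolding f_def p_def[symmetric] lhs shift shift' by (simp add: algebra_simps)
  qed
  have "f z = 0"
    using quasi_periodic_eq_0[OF _ norm_square_less_1[OF assms(2)] holo quasi] assms by simp
  thus ?thesis by (simp add: f_def)
qed

text \<open>Using \<open>has_sum\<close> makes unconditional convergence of the double sum part of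
  the claim. \<open>F8_defined\<close> excludes the odd powers of \<open>q\<close> as values of
  \<open>z\<close>, where a denominator of \<open>F8\<close> vanishes.\<close>

theorem theorem3p8:
  fixes q z :: complex
  assumes "0 < norm q" and "norm q < 1"
    and "z \<noteq> 0" and "z \<noteq> 1"
    and F8_defined: "\<And>n. qpochs [z * q, q / z] (q\<^sup>2) (n + 1) \<noteq> 0"
  shows "((\<lambda>(n::int, j::int). sg n * (-1) powi (j - 1) * q powi (2 * n\<^sup>2 - n - j\<^sup>2 + j)
             * ((z powi (1 - j) - z powi j) / (1 - z)))
          has_sum (qpochs_inf [z * q, q / z, q\<^sup>2] (q\<^sup>2) * F8 z q))
          {(n, j). 1 \<le> j \<and> j \<le> \<bar>n\<bar>}"
proof -
  have q: "q \<noteq> 0" using assms(1) by auto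
  let ?t = "\<lambda>(n::int, j::int). sg n * (-1) powi (j - 1) * q powi (2 * n\<^sup>2 - n - j\<^sup>2 + j)
             * ((z powi (1 - j) - z powi j) / (1 - z))"
  \<comment> \<open>With \<open>j = k + 1\<close> the numerator \<open>z^(1-j) - z^j\<close> is
    \<open>(1/z)^k - z * z^k\<close>, hence the two Hecke terms at \<open>1 / z\<close> and
    \<open>z\<close>.\<close>
  let ?h = "\<lambda>x. (hecke_term q (1 / z) x + (- z) * hecke_term q z x) / (1 - z)"
  have "qpochs_inf [z * q, q / z, q\<^sup>2] (q\<^sup>2) * F8 z q
      = (hecke_sum q (1 / z) + (- z) * hecke_sum q z) / (1 - z)"
    using F8_series_eq_hecke[OF q assms(2,3)] F8_eq_series[OF assms(2) F8_defined] assms(4)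
    by (simp add: field_simps)
  moreover have "(?h has_sum ((hecke_sum q (1 / z) + (- z) * hecke_sum q z) / (1 - z))) hecke_cone"
    by (intro has_sum_divide_const has_sum_add has_sum_cmult_right hecke_has_sum q assms(2))
  moreover have "(?t has_sum s) {(n, j). 1 \<le> j \<and> j \<le> \<bar>n\<bar>} \<longleftrightarrow> (?h has_sum s) hecke_cone" for s
  proof (rule has_sum_reindex_bij_witness[where i = "\<lambda>(k, n). (n, int k + 1)" and j = "\<lambda>(n, j). (nat (j - 1), n)"])
    fix x :: "int \<times> int"
    assume "x \<in> {(n, j). 1 \<le> j \<and> j \<le> \<bar>n\<bar>}"
    then obtain n j where x: "x = (n, j)" "1 \<le> j" by auto
    define k where "k = nat (j - 1)"
    have j: "j = int k + 1" using x by (simp add: k_def)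
    define a where "a = sg n * (-1) ^ k * q powi (2 * n\<^sup>2 - n - (int k)\<^sup>2 - int k)"
    have "2 * n\<^sup>2 - n - j\<^sup>2 + j = 2 * n\<^sup>2 - n - (int k)\<^sup>2 - int k"
      by (simp add: j power2_eq_square algebra_simps)
    moreover have "z powi (1 - j) = (1 / z) ^ k" "z powi j = z * z ^ k"
      using assms(3) by (simp_all add: j power_int_add power_int_minus power_one_over inverse_eq_divide)
    moreover have "(-1 :: complex) powi (j - 1) = (-1) ^ k"
      by (simp add: j)
    ultimately have "?t x = a * (((1 / z) ^ k - z * z ^ k) / (1 - z))"
      unfolding x by (simp only: prod.case a_def)
    also have "\<dots> = (a * (1 / z) ^ k + (- z) * (a * z ^ k)) / (1 - z)"
      by (simp add: algebra_simps)
    also have "\<dots> = ?h (k, n)"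
      by (simp only: hecke_term_def prod.case a_def mult.commute[of "sg n"])
    finally show "?h (case x of (n, j) \<Rightarrow> (nat (j - 1), n)) = ?t x"
      by (simp only: x prod.case k_def)
  qed auto
  ultimately show ?thesis by simp
qed

end
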